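(* Let $r>\frac12$ and $s>\max(1,2r-1)$, and let $y(s,r)=s+\mathop{K}_{n=1}^{\infty}\left(\dfrac{(2n-1)^2r^2-(r-1)^2}{2s}\right)$. Then $$\frac{\partial^2}{\partial s^2}(\ln y)(s,r)=-\frac{1}{2r^2}\int_0^{\infty}\frac{x\left(e^{-\frac{1-r+s}{r}x}+e^{-\frac{r-1+s}{r}x}\right)}{\cosh x}\,dx=-h_1(s,r)-h_2(s,r),$$ where $$h_1(s,r)=\dfrac{1}{2(1-2r+s)(1+s)+2\,\mathrm{TK}_{n=1}^{\infty}\left(\frac{4n^2r^2}{1}+\frac{4n^2r^2}{(1-2r+s)(1+s)}\right)},$$ $$h_2(s,r)=\dfrac{1}{2(2r-1+s)(s-1)+2\,\mathrm{TK}_{n=1}^{\infty}\left(\frac{4n^2r^2}{1}+\frac{4n^2r^2}{(2r-1+s)(s-1)}\right)}.$$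
   Context: $\mathop{K}_{n=1}^{\infty}\left(\frac{a_n}{b_n}\right)$ denotes the continued fraction $\cfrac{a_1}{b_1+\cfrac{a_2}{b_2+\cdots}}$ (limit of convergents). For a quantity $c$ and constant $A$, the notation $c+\mathrm{TK}_{n=1}^\infty\left(\frac{An^2}{1}+\frac{An^2}{c}\right)$ denotes the continued fraction $$c+\cfrac{A\cdot1^2}{1+\cfrac{A\cdot1^2}{c+\cfrac{A\cdot2^2}{1+\cfrac{A\cdot 2^2}{c+\cdots}}}},$$ i.e. partial numerators $A1^2,A1^2,A2^2,A2^2,A3^2,\dots$ and partial denominators alternating $1,c,1,c,\dots$; $2c+2\,\mathrm{TK}(\cdots)$ means twice this quantity. *)

theory Defs
  imports "HOL-Analysis.Analysis"
begin

fun cf_tail :: "(nat \<Rightarrow> real) \<Rightarrow> (nat \<Rightarrow> real) \<Rightarrow> nat \<Rightarrow> nat \<Rightarrow> real" where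
  "cf_tail a b 0 n = 0"
| "cf_tail a b (Suc m) n = a n / (b n + cf_tail a b m (Suc n))"

definition cf_conv :: "(nat \<Rightarrow> real) \<Rightarrow> (nat \<Rightarrow> real) \<Rightarrow> nat \<Rightarrow> real" where
  "cf_conv a b N = cf_tail a b N 1"

definition cf_converges :: "(nat \<Rightarrow> real) \<Rightarrow> (nat \<Rightarrow> real) \<Rightarrow> bool" where
  "cf_converges a b \<longleftrightarrow> convergent (cf_conv a b)"

definition cfK :: "(nat \<Rightarrow> real) \<Rightarrow> (nat \<Rightarrow> real) \<Rightarrow> real" where
  "cfK a b = lim (cf_conv a b)"

text \<open>TK data: partial numerators A*1^2, A*1^2, A*2^2, A*2^2, ... and
  partial denominators 1, c, 1, c, ... (indexed from 1).\<close>
definition tk_num :: "real \<Rightarrow> nat \<Rightarrow> real" where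
  "tk_num A k = A * (of_nat ((k + 1) div 2))\<^sup>2"

definition tk_den :: "real \<Rightarrow> nat \<Rightarrow> real" where
  "tk_den c k = (if odd k then 1 else c)"

text \<open>c + TK_{n=1}^infty (A n^2/1 + A n^2/c).\<close>
definition TK :: "real \<Rightarrow> real \<Rightarrow> real" where
  "TK c A = c + cfK (tk_num A) (tk_den c)"

definition y_num :: "real \<Rightarrow> nat \<Rightarrow> real" where
  "y_num r n = (2 * of_nat n - 1)\<^sup>2 * r\<^sup>2 - (r - 1)\<^sup>2"

definition yfun :: "real \<Rightarrow> real \<Rightarrow> real" where
  "yfun s r = s + cfK (y_num r) (\<lambda>n. 2 * s)"

definition h1 :: "real \<Rightarrow> real \<Rightarrow> real" where
  "h1 s r = 1 / (2 * TK ((1 - 2*r + s) * (1 + s)) (4 * r\<^sup>2))"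

definition h2 :: "real \<Rightarrow> real \<Rightarrow> real" where
  "h2 s r = 1 / (2 * TK ((2*r - 1 + s) * (s - 1)) (4 * r\<^sup>2))"

end

theory Submission
  imports Defs "HOL-Real_Asymp.Real_Asymp"
begin

text \<open>
  A continued fraction with positive elements whose partial numerators grow at most quadratically
  converges, and its value is read off from any sequence of positive numbers that satisfies the
  recurrence of its tails. For both fractions of the theorem a contiguity relation carries the
  tails at a shifted parameter to positive tails at the original parameter. This gives
  \<open>y(s) * y(s + 2r) = (s + 1) * (s + 2r - 1)\<close> and, with \<open>G(\<nu>) = TK (A\<nu>(\<nu> + 1)) A\<close>,
  \<open>1 / G(\<nu>) + 1 / G(\<nu> + 1) = 2 / (A(\<nu> + 1)\<^sup>2)\<close>.

  The first equation and the growth of \<open>y\<close> determine \<open>y\<close> as a product of Gamma quotients, so that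
  \<open>(ln y)''\<close> is a combination of trigamma values. The trigamma differences, the integrals
  \<open>\<integral> x * exp (-(2\<nu> + 1) * x) / cosh x\<close> and \<open>1 / G\<close> satisfy the same equation
  \<open>F(\<nu>) + F(\<nu> + 1) = const / (\<nu> + 1)\<^sup>2\<close> and tend to \<open>0\<close>, hence they agree up to a constant factor.
\<close>

section \<open>Continued fractions with positive elements\<close>

text \<open>These are the classical continuants. Index 0 is the empty fraction \<open>0 / 1\<close>,
  and \<open>a 1\<close> enters only the numerators.\<close>

fun cf_den :: "(nat \<Rightarrow> real) \<Rightarrow> (nat \<Rightarrow> real) \<Rightarrow> nat \<Rightarrow> real" where
  "cf_den a b 0 = 1"
| "cf_den a b (Suc 0) = b 1"
| "cf_den a b (Suc (Suc n)) = b (Suc (Suc n)) * cf_den a b (Suc n) + a (Suc (Suc n)) * cf_den a b n"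

fun cf_numer :: "(nat \<Rightarrow> real) \<Rightarrow> (nat \<Rightarrow> real) \<Rightarrow> nat \<Rightarrow> real" where
  "cf_numer a b 0 = 0"
| "cf_numer a b (Suc 0) = a 1"
| "cf_numer a b (Suc (Suc n)) = b (Suc (Suc n)) * cf_numer a b (Suc n) + a (Suc (Suc n)) * cf_numer a b n"

text \<open>A finite fraction with remainder \<open>x\<close> in place of the innermost 0, so that
  convergents (\<open>x = 0\<close>) and exact values (\<open>x\<close> a true tail) are compared
  within one formula.\<close>

fun cf_from :: "(nat \<Rightarrow> real) \<Rightarrow> (nat \<Rightarrow> real) \<Rightarrow> nat \<Rightarrow> nat \<Rightarrow> real \<Rightarrow> real" where
  "cf_from a b 0 n x = x"
| "cf_from a b (Suc m) n x = a n / (b n + cf_from a b m (Suc n) x)"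

lemma cf_tail_eq_cf_from: "cf_tail a b m n = cf_from a b m n 0"
  by (induction m arbitrary: n) auto

lemma cf_from_Suc_right:
  "cf_from a b (Suc m) n x = cf_from a b m n (a (n + m) / (b (n + m) + x))"
  by (induction m arbitrary: n) auto

lemma cf_from_add: "cf_from a b (m + k) n x = cf_from a b m n (cf_from a b k (n + m) x)"
  by (induction m arbitrary: n) auto

lemma cf_from_shift:
  "cf_from (\<lambda>i. a (i + k)) (\<lambda>i. b (i + k)) m n x = cf_from a b m (n + k) x"
  by (induction m arbitrary: n) auto

lemma cf_tail_shift:
  "cf_tail (\<lambda>i. a (i + k)) (\<lambda>i. b (i + k)) m n = cf_tail a b m (n + k)"
  by (simp add: cf_tail_eq_cf_from cf_from_shift)

text \<open>The bounds with \<open>\<beta>\<close> and \<open>K\<close> are what makes the gaps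
  between convergents shrink: together they bring in the divergence of the harmonic series.\<close>

locale pos_cf =
  fixes a b :: "nat \<Rightarrow> real" and K \<beta> :: real
  assumes a_pos: "n \<ge> 1 \<Longrightarrow> a n > 0"
    and b_ge: "n \<ge> 1 \<Longrightarrow> b n \<ge> \<beta>"
    and beta_pos: "\<beta> > 0"
    and a_le: "n \<ge> 1 \<Longrightarrow> a n \<le> (K * real n)\<^sup>2"
    and K_pos: "K > 0"
begin

lemma b_pos: "n \<ge> 1 \<Longrightarrow> b n > 0"
  using b_ge[of n] beta_pos by linarith

lemma cf_den_pos: "cf_den a b n > 0"
proof (induction n rule: induct_nat_012)
  case (ge2 n)
  then show ?case using a_pos[of "Suc (Suc n)"] b_pos[of "Suc (Suc n)"] by (simp add: add_pos_pos)
qed (use b_pos[of 1] in auto)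

lemma cf_from_nonneg: "x \<ge> 0 \<Longrightarrow> n \<ge> 1 \<Longrightarrow> cf_from a b m n x \<ge> 0"
proof (induction m arbitrary: n)
  case (Suc m)
  then show ?case using a_pos[of n] b_pos[of n] Suc.IH[of "Suc n"] by (auto intro!: divide_nonneg_pos add_pos_nonneg)
qed auto

text \<open>A finite fraction is a Moebius map of its remainder. In the induction the innermost
  level \<open>c / d\<close> serves as the remainder of the shorter fraction, and multiplying
  through by \<open>d\<close> yields the three-term recurrences.\<close>

lemma cf_from_eq:
  assumes "x \<ge> 0"
  shows "cf_from a b (Suc m) 1 x =
    (cf_numer a b (Suc m) + x * cf_numer a b m) / (cf_den a b (Suc m) + x * cf_den a b m)"
  using assms
proof (induction m arbitrary: x)
  case 0
  then show ?case by simp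
next
  case (Suc m)
  define c d where "c = a (Suc (Suc m))" and "d = b (Suc (Suc m)) + x"
  have c: "c > 0" and d: "d > 0"
    using a_pos[of "Suc (Suc m)"] b_pos[of "Suc (Suc m)"] Suc.prems by (auto simp: c_def d_def)
  have "cf_from a b (Suc (Suc m)) 1 x = cf_from a b (Suc m) 1 (c / d)"
    by (subst cf_from_Suc_right) (simp add: c_def d_def)
  also have "\<dots> = (cf_numer a b (Suc m) + c / d * cf_numer a b m) / (cf_den a b (Suc m) + c / d * cf_den a b m)"
    using c d by (intro Suc.IH) auto
  also have "\<dots> = (d * (cf_numer a b (Suc m) + c / d * cf_numer a b m)) / (d * (cf_den a b (Suc m) + c / d * cf_den a b m))"
    using d by simp
  also have "d * (cf_numer a b (Suc m) + c / d * cf_numer a b m) = cf_numer a b (Suc (Suc m)) + x * cf_numer a b (Suc m)"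
    using d by (simp add: distrib_left) (simp add: c_def d_def algebra_simps)
  also have "d * (cf_den a b (Suc m) + c / d * cf_den a b m) = cf_den a b (Suc (Suc m)) + x * cf_den a b (Suc m)"
    using d by (simp add: distrib_left) (simp add: c_def d_def algebra_simps)
  finally show ?case .
qed

text \<open>Each step multiplies the determinant by \<open>- a (Suc (Suc m))\<close>; the absolute
  value discards the alternating sign.\<close>

lemma cf_determinant:
  "\<bar>cf_numer a b (Suc m) * cf_den a b m - cf_numer a b m * cf_den a b (Suc m)\<bar> = (\<Prod>i=1..Suc m. a i)"
proof (induction m)
  case 0
  then show ?case using a_pos[of 1] by simp
next
  case (Suc m)
  have "cf_numer a b (Suc (Suc m)) * cf_den a b (Suc m) - cf_numer a b (Suc m) * cf_den a b (Suc (Suc m))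
     = - a (Suc (Suc m)) * (cf_numer a b (Suc m) * cf_den a b m - cf_numer a b m * cf_den a b (Suc m))"
    by (simp add: algebra_simps)
  then have "\<bar>cf_numer a b (Suc (Suc m)) * cf_den a b (Suc m) - cf_numer a b (Suc m) * cf_den a b (Suc (Suc m))\<bar>
     = a (Suc (Suc m)) * (\<Prod>i=1..Suc m. a i)"
    using Suc.IH a_pos[of "Suc (Suc m)"] by (simp add: abs_mult)
  then show ?case by (simp add: mult_ac)
qed

text \<open>Reciprocal of the distance between the convergents of orders \<open>m\<close> and
  \<open>Suc m\<close>; it grows by explicit positive increments.\<close>

definition inv_gap :: "nat \<Rightarrow> real" where
  "inv_gap m = cf_den a b (Suc m) * cf_den a b m / (\<Prod>i=1..Suc m. a i)"

lemma prod_a_pos: "(\<Prod>i=1..n. a i) > 0"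
  by (intro prod_pos) (auto intro: a_pos)

lemma inv_gap_pos: "inv_gap m > 0"
  unfolding inv_gap_def by (intro divide_pos_pos mult_pos_pos prod_a_pos cf_den_pos)

text \<open>By the Moebius form and the determinant, the difference is
  \<open>x * P / (B * (B + x * B'))\<close>, which stays below its limit \<open>P / (B * B')\<close>
  for large \<open>x\<close>. The bound is therefore uniform in the remainder.\<close>

lemma cf_from_diff_le:
  assumes "x \<ge> 0"
  shows "\<bar>cf_from a b (Suc m) 1 x - cf_tail a b (Suc m) 1\<bar> \<le> 1 / inv_gap m"
proof -
  define A B A' B' P where "A = cf_numer a b (Suc m)" and "B = cf_den a b (Suc m)"
    and "A' = cf_numer a b m" and "B' = cf_den a b m" and "P = (\<Prod>i=1..Suc m. a i)"
  have B: "B > 0" "B' > 0" "P > 0" unfolding B_def B'_def P_def by (rule cf_den_pos cf_den_pos prod_a_pos)+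
  have xB: "B + x * B' > 0" using B assms by (intro add_pos_nonneg) auto
  have "cf_from a b (Suc m) 1 x - cf_tail a b (Suc m) 1 = (A + x * A') / (B + x * B') - A / B"
    using cf_from_eq[OF assms, of m] cf_from_eq[of 0 m] by (simp add: cf_tail_eq_cf_from A_def B_def A'_def B'_def)
  also have "\<dots> = - (x * (A * B' - A' * B)) / (B * (B + x * B'))"
    using B xB by (simp add: field_simps)
  finally have "\<bar>cf_from a b (Suc m) 1 x - cf_tail a b (Suc m) 1\<bar> = x * P / (B * (B + x * B'))"
    using cf_determinant[of m] assms B xB by (simp add: abs_mult A_def B_def A'_def B'_def P_def)
  also have "\<dots> \<le> P / (B * B')"
    using B xB assms by (simp add: divide_simps)
  also have "\<dots> = 1 / inv_gap m" by (simp add: inv_gap_def B_def B'_def P_def)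
  finally show ?thesis .
qed

lemma inv_gap_Suc:
  "inv_gap (Suc m) = inv_gap m + b (m + 2) * (cf_den a b (Suc m))\<^sup>2 / (\<Prod>i=1..m+2. a i)"
proof -
  define P A where "P = (\<Prod>i=1..Suc m. a i)" and "A = a (m + 2)"
  have A: "A > 0" unfolding A_def by (intro a_pos) simp
  have P: "P > 0" unfolding P_def by (rule prod_a_pos)
  have "(\<Prod>i=1..Suc (Suc m). a i) = P * A" "(\<Prod>i=1..m+2. a i) = P * A"
    by (simp_all add: P_def A_def)
  moreover have "cf_den a b (Suc (Suc m)) = b (m + 2) * cf_den a b (Suc m) + A * cf_den a b m"
    by (simp add: A_def)
  moreover have "(y * x + A * z) * x / (P * A) = x * z / P + y * x\<^sup>2 / (P * A)" for x y z
    using A P by (simp add: field_simps power2_eq_square)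
  ultimately show ?thesis
    unfolding inv_gap_def P_def[symmetric] by (simp del: cf_den.simps prod.cl_ivl_Suc)
qed

lemma inv_gap_mono: "inv_gap m \<le> inv_gap (Suc m)"
  unfolding inv_gap_Suc using b_pos[of "m+2"] prod_a_pos[of "m+2"] by simp

text \<open>The product of two consecutive increments is at least a multiple of \<open>1 / m\<^sup>2\<close>,
  so by AM-GM their sum dominates a term of the harmonic series.\<close>

lemma inv_gap_step:
  "inv_gap (m + 2) \<ge> inv_gap m + 2 * \<beta> * inv_gap 0 / K / real (m + 3)"
proof -
  define c where "c k = b (k + 2) * (cf_den a b (Suc k))\<^sup>2 / (\<Prod>i=1..k+2. a i)" for k
  have c_pos: "c k > 0" for k
    unfolding c_def using b_pos[of "k+2"] cf_den_pos[of "Suc k"] prod_a_pos[of "k+2"] by simp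
  have A: "a (m + 3) > 0" using a_pos by simp
  \<comment> \<open>The squared denominators recombine to the square of
    \<open>inv_gap (Suc m)\<close>, since the two products of numerators differ by the single factor
    \<open>a (m + 3)\<close>.\<close>
  have "c m * c (Suc m) = b (m+2) * b (m+3) * (inv_gap (Suc m))\<^sup>2 / a (m + 3)"
    using prod_a_pos[of "m+2"] A
    by (simp add: c_def inv_gap_def power2_eq_square eval_nat_numeral mult_ac)
  also have "\<dots> \<ge> \<beta> * \<beta> * (inv_gap 0)\<^sup>2 / (K * real (m + 3))\<^sup>2"
  proof (intro frac_le mult_mono power_mono)
    show "inv_gap 0 \<le> inv_gap (Suc m)" by (rule lift_Suc_mono_le[of inv_gap]) (auto intro: inv_gap_mono)
    show "a (m + 3) \<le> (K * real (m + 3))\<^sup>2" by (rule a_le) auto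
  qed (use beta_pos A in \<open>auto intro!: mult_nonneg_nonneg b_ge less_imp_le[OF b_pos] less_imp_le[OF inv_gap_pos]\<close>)
  finally have "(\<beta> * inv_gap 0 / (K * real (m + 3)))\<^sup>2 \<le> c m * c (Suc m)"
    by (simp add: power2_eq_square power_divide mult_ac)
  moreover have "4 * (c m * c (Suc m)) \<le> (c m + c (Suc m))\<^sup>2"
    using zero_le_power2[of "c m - c (Suc m)"] by (simp add: power2_eq_square algebra_simps)
  ultimately have "(2 * (\<beta> * inv_gap 0 / (K * real (m + 3))))\<^sup>2 \<le> (c m + c (Suc m))\<^sup>2"
    unfolding power_mult_distrib[of 2] by simp
  then have "2 * (\<beta> * inv_gap 0 / (K * real (m + 3))) \<le> c m + c (Suc m)"
    by (rule power2_le_imp_le) (simp add: add_nonneg_nonneg less_imp_le c_pos)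
  moreover have "inv_gap (m + 2) = inv_gap m + c m + c (Suc m)"
    using inv_gap_Suc[of m] inv_gap_Suc[of "Suc m"] by (simp add: c_def)
  ultimately show ?thesis by (simp add: mult_ac)
qed

lemma inv_gap_at_top: "filterlim inv_gap at_top sequentially"
proof -
  define C where "C = \<beta> * inv_gap 0 / K"
  have C: "C > 0" using beta_pos inv_gap_pos K_pos by (simp add: C_def)
  \<comment> \<open>Subtracting \<open>C\<close> removes the first harmonic term, so that the case
    \<open>m = 0\<close> is just positivity.\<close>
  have ge: "inv_gap (2 * m) \<ge> C * harm (Suc m) - C" for m
  proof (induction m)
    case 0
    then show ?case using inv_gap_pos[of 0] by (simp add: harm_def)
  next
    case (Suc m)
    have "C * inverse (real (Suc (Suc m))) \<le> 2 * C / real (2 * m + 3)"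
      using C by (simp add: field_simps)
    also have "\<dots> \<le> inv_gap (2 * m + 2) - inv_gap (2 * m)"
      using inv_gap_step[of "2 * m"] by (simp add: C_def mult_ac)
    finally show ?case using Suc by (simp add: harm_Suc algebra_simps)
  qed
  have "filterlim (\<lambda>m. harm (Suc m) :: real) at_top sequentially"
    using harm_at_top filterlim_compose filterlim_Suc by blast
  then have "filterlim (\<lambda>m. - C + C * harm (Suc m)) at_top sequentially"
    by (intro filterlim_tendsto_add_at_top[OF tendsto_const] filterlim_tendsto_pos_mult_at_top[OF tendsto_const C])
  then have 1: "filterlim (\<lambda>m. inv_gap (2 * m)) at_top sequentially"
    by (rule filterlim_at_top_mono) (use ge in \<open>auto simp: algebra_simps\<close>)
  \<comment> \<open>Monotonicity extends the divergence from the even indices to all.\<close>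
  have "incseq inv_gap" by (intro incseq_SucI inv_gap_mono)
  have "\<forall>\<^sub>F m in sequentially. inv_gap m \<ge> Z" for Z
  proof -
    obtain M where "inv_gap (2 * M) \<ge> Z"
      using 1 unfolding filterlim_at_top eventually_sequentially by blast
    then show ?thesis
      using \<open>incseq inv_gap\<close> unfolding eventually_sequentially incseq_def by (meson order_trans)
  qed
  then show ?thesis by (simp add: filterlim_at_top)
qed

lemma gap_tendsto: "(\<lambda>m. 1 / inv_gap m) \<longlonglongrightarrow> 0"
  by (rule tendsto_divide_0[OF tendsto_const filterlim_at_top_imp_at_infinity[OF inv_gap_at_top]])

text \<open>Every convergent from order \<open>Suc M\<close> on is the one of order
  \<open>Suc M\<close> with a nonnegative remainder, hence within \<open>1 / inv_gap M\<close> of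
  it.\<close>

lemma cf_converges: "cf_converges a b"
  unfolding cf_converges_def
proof (rule Cauchy_convergent, rule metric_CauchyI)
  fix e :: real assume "e > 0"
  then have "\<forall>\<^sub>F m in sequentially. 1 / inv_gap m < e / 2"
    by (intro order_tendstoD(2)[OF gap_tendsto]) simp
  then obtain M where M: "1 / inv_gap M < e / 2" by (auto simp: eventually_sequentially)
  have close: "\<bar>cf_conv a b n - cf_conv a b (Suc M)\<bar> < e / 2" if "n \<ge> Suc M" for n
  proof -
    have "cf_conv a b n = cf_from a b (Suc M + (n - Suc M)) 1 0"
      using that by (simp add: cf_conv_def cf_tail_eq_cf_from)
    also have "\<dots> = cf_from a b (Suc M) 1 (cf_from a b (n - Suc M) (1 + Suc M) 0)"
      by (rule cf_from_add)
    finally show ?thesis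
      using cf_from_diff_le[OF cf_from_nonneg[of 0 "1 + Suc M" "n - Suc M"], of M] M
      by (simp add: cf_conv_def)
  qed
  show "\<exists>M. \<forall>m\<ge>M. \<forall>n\<ge>M. dist (cf_conv a b m) (cf_conv a b n) < e"
  proof (intro exI allI impI)
    fix m n assume "m \<ge> Suc M" "n \<ge> Suc M"
    then show "dist (cf_conv a b m) (cf_conv a b n) < e"
      using close[of m] close[of n] unfolding dist_real_def by linarith
  qed
qed

text \<open>Unrolling the recurrence writes \<open>u 1\<close> as a finite fraction of order
  \<open>Suc m\<close> with a positive remainder, so it lies within \<open>1 / inv_gap m\<close> of
  the convergent.\<close>

lemma cfK_eq_tail:
  assumes pos: "\<And>n. n \<ge> 1 \<Longrightarrow> u n > 0"
    and rec: "\<And>n. n \<ge> 1 \<Longrightarrow> u n = a n / (b n + u (Suc n))"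
  shows "cfK a b = u 1"
proof -
  have u: "u n = cf_from a b m n (u (n + m))" if "n \<ge> 1" for m n
    using that
  proof (induction m arbitrary: n)
    case (Suc m)
    have "u (Suc n) = cf_from a b m (Suc n) (u (Suc n + m))" by (rule Suc.IH) simp
    with rec[OF Suc.prems] show ?case by simp
  qed simp
  have "(\<lambda>m. cf_tail a b (Suc m) 1 - u 1) \<longlonglongrightarrow> 0"
  proof (rule Lim_null_comparison[OF _ gap_tendsto], intro always_eventually allI)
    fix m
    have "u 1 = cf_from a b (Suc m) 1 (u (1 + Suc m))" by (rule u) simp
    with cf_from_diff_le[of "u (1 + Suc m)" m] pos[of "1 + Suc m"]
    show "norm (cf_tail a b (Suc m) 1 - u 1) \<le> 1 / inv_gap m"
      by (simp del: cf_from.simps cf_tail.simps) 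
  qed
  then have "(\<lambda>m. cf_conv a b (Suc m)) \<longlonglongrightarrow> u 1"
    unfolding cf_conv_def by (simp add: LIM_zero_iff)
  then show ?thesis
    unfolding cfK_def by (metis filterlim_sequentially_Suc limI)
qed

end

section \<open>Tails of a convergent fraction\<close>

lemma pos_cf_shift:
  assumes "pos_cf a b K \<beta>"
  shows "pos_cf (\<lambda>i. a (i + k)) (\<lambda>i. b (i + k)) (K * real (Suc k)) \<beta>"
proof -
  interpret pos_cf a b K \<beta> by fact
  show ?thesis
  proof
    fix n :: nat assume n: "n \<ge> 1"
    show "a (n + k) > 0" "b (n + k) \<ge> \<beta>" using a_pos b_ge n by auto
    \<comment> \<open>The shift of indices costs the factor \<open>Suc k\<close> in the quadratic
      bound.\<close>
    have "n + k \<le> Suc k * n" using n by (cases n) auto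
    then have *: "real (n + k) \<le> real (Suc k) * real n" by (metis of_nat_le_iff of_nat_mult)
    have "a (n + k) \<le> (K * real (n + k))\<^sup>2" using n by (intro a_le) simp
    also have "\<dots> \<le> (K * real (Suc k) * real n)\<^sup>2"
      unfolding mult.assoc using * K_pos by (intro power_mono mult_left_mono) auto
    finally show "a (n + k) \<le> (K * real (Suc k) * real n)\<^sup>2" .
  qed (use beta_pos K_pos in auto)
qed

context pos_cf
begin

text \<open>The tails are the values of the shifted fractions. A limit only inherits nonnegativity;
  strict positivity comes back from the recurrence, since \<open>a n > 0\<close>.\<close>

lemma cf_tails_exist:
  obtains u where "\<And>n. n \<ge> 1 \<Longrightarrow> u n > 0" "\<And>n. n \<ge> 1 \<Longrightarrow> u n = a n / (b n + u (Suc n))" "cfK a b = u 1"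
proof -
  define u where "u n = lim (\<lambda>m. cf_tail a b m n)" for n
  have lim: "(\<lambda>m. cf_tail a b m n) \<longlonglongrightarrow> u n" if "n \<ge> 1" for n
  proof -
    interpret sh: pos_cf "\<lambda>i. a (i + (n - 1))" "\<lambda>i. b (i + (n - 1))" "K * real (Suc (n - 1))" \<beta>
      by (rule pos_cf_shift) unfold_locales
    have "cf_conv (\<lambda>i. a (i + (n - 1))) (\<lambda>i. b (i + (n - 1))) = (\<lambda>m. cf_tail a b m n)"
      using that unfolding cf_conv_def cf_tail_shift by simp
    then show ?thesis using sh.cf_converges
      by (simp add: cf_converges_def convergent_LIMSEQ_iff u_def)
  qed
  have nonneg: "u n \<ge> 0" if "n \<ge> 1" for n
    by (rule LIMSEQ_le_const[OF lim[OF that]])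
       (use cf_from_nonneg[OF order_refl that] in \<open>auto simp: cf_tail_eq_cf_from\<close>)
  have rec: "u n = a n / (b n + u (Suc n))" if "n \<ge> 1" for n
  proof (rule LIMSEQ_unique[OF LIMSEQ_Suc[OF lim[OF that]]])
    have "b n + u (Suc n) > 0" using b_pos[OF that] nonneg[of "Suc n"] by simp
    then show "(\<lambda>m. cf_tail a b (Suc m) n) \<longlonglongrightarrow> a n / (b n + u (Suc n))"
      by (auto intro!: tendsto_intros lim)
  qed
  have pos: "u n > 0" if "n \<ge> 1" for n
    using rec[OF that] a_pos[OF that] b_pos[OF that] nonneg[of "Suc n"] by (simp add: add_pos_nonneg)
  show ?thesis
    using pos rec cfK_eq_tail[OF pos rec] by (rule that)
qed

end

section \<open>The fractions of the theorem and their functional equations\<close>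

lemma y_num_pos:
  assumes "r > 1/2" "n \<ge> 1"
  shows "y_num r n > 0"
proof -
  have n: "real n \<ge> 1" using assms by simp
  have "r * 1 \<le> r * real n" using n assms by (intro mult_left_mono) auto
  \<comment> \<open>The factors of the difference of squares, \<open>(2 * n - 1) * r\<close> plus
    and minus \<open>r - 1\<close>.\<close>
  then have "2 * real n * r - 1 > 0" and "(2 * real n - 2) * r + 1 > 0"
    using assms(1) unfolding left_diff_distrib mult.assoc mult.commute[of "real n"] by linarith+
  then have "((2 * real n - 2) * r + 1) * (2 * real n * r - 1) > 0" by simp
  then show ?thesis by (simp add: y_num_def power2_eq_square algebra_simps)
qed

lemma y_num_Suc: "y_num r (Suc n) = y_num r n + 8 * r\<^sup>2 * real n"
  by (simp add: y_num_def power2_eq_square algebra_simps)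

lemma pos_cf_y:
  assumes "r > 1/2" "s > 0"
  shows "pos_cf (y_num r) (\<lambda>n. 2 * s) (2 * r) (2 * s)"
proof
  fix n :: nat assume n: "n \<ge> 1"
  have "y_num r n \<le> ((2 * real n - 1) * r)\<^sup>2"
    by (simp add: y_num_def power_mult_distrib)
  also have "\<dots> \<le> (2 * r * real n)\<^sup>2"
    using n assms by (intro power_mono) (auto simp: algebra_simps)
  finally show "y_num r n \<le> (2 * r * real n)\<^sup>2" .
qed (use assms y_num_pos in auto)

text \<open>Dropping the second tail from the first denominator gives the upper bound. The two
  bounds fix the growth of \<open>yfun\<close>, which later singles out the Gamma solution of its
  functional equation.\<close>

lemma yfun_bounds:
  assumes "r > 1/2" "s > 0"
  shows "s < yfun s r" "yfun s r \<le> s + (2 * r - 1) / (2 * s)"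
proof -
  interpret pos_cf "y_num r" "\<lambda>n. 2 * s" "2 * r" "2 * s" by (rule pos_cf_y[OF assms])
  obtain u where u: "\<And>n. n \<ge> 1 \<Longrightarrow> u n > 0"
    "\<And>n. n \<ge> 1 \<Longrightarrow> u n = y_num r n / (2 * s + u (Suc n))"
    "cfK (y_num r) (\<lambda>n. 2 * s) = u 1"
    using cf_tails_exist by blast
  have "y_num r 1 = 2 * r - 1" by (simp add: y_num_def power2_eq_square algebra_simps)
  then have "u 1 \<le> (2 * r - 1) / (2 * s)"
    using u(1)[of 2] u(2)[of 1] assms by (simp add: numeral_2_eq_2 frac_le)
  then show "s < yfun s r" "yfun s r \<le> s + (2 * r - 1) / (2 * s)"
    using u(1)[of 1] u(3) by (auto simp: yfun_def)
qed

text \<open>The tails at \<open>s + 2 * r\<close> are carried to positive tails at \<open>s\<close> by a contiguity relation;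
  since positive tails are unique, this relates the two values.\<close>

lemma yfun_functional_equation:
  assumes r: "r > 1/2" and s: "s > 0"
  shows "yfun s r * yfun (s + 2 * r) r = (s + 1) * (s + 2 * r - 1)"
proof -
  interpret Y: pos_cf "y_num r" "\<lambda>n. 2 * s" "2 * r" "2 * s"
    by (rule pos_cf_y[OF r s])
  interpret Y': pos_cf "y_num r" "\<lambda>n. 2 * (s + 2 * r)" "2 * r" "2 * (s + 2 * r)"
    by (rule pos_cf_y[OF r]) (use r s in simp)
  obtain u where u_pos: "\<And>n. n \<ge> 1 \<Longrightarrow> u n > 0"
    and u_rec: "\<And>n. n \<ge> 1 \<Longrightarrow> u n = y_num r n / (2 * (s + 2 * r) + u (Suc n))"
    and u_val: "cfK (y_num r) (\<lambda>n. 2 * (s + 2 * r)) = u 1"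
    using Y'.cf_tails_exist by blast
  have u_mult: "u n * (2 * (s + 2 * r) + u (Suc n)) = y_num r n" if "n \<ge> 1" for n
  proof -
    have "2 * (s + 2 * r) + u (Suc n) > 0" using u_pos[of "Suc n"] r s by simp
    then show ?thesis using u_rec[OF that] by simp
  qed
  \<comment> \<open>\<open>W 0\<close> is the value \<open>yfun (s + 2 * r) r\<close>; the summand
    \<open>2 * r * real n\<close> is what makes \<open>v\<close> satisfy the recurrence at
    \<open>s\<close>.\<close>
  define W where "W n = s + 2 * r + 2 * r * real n + u (Suc n)" for n
  have W_pos: "W n > 0" for n
    unfolding W_def using r s u_pos[of "Suc n"] by (intro add_pos_pos add_pos_nonneg) auto
  define v where "v n = u n * W n / W (n - 1)" for n
  \<comment> \<open>This is the recurrence of \<open>v\<close> cleared of denominators. After use of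
    \<open>u_mult\<close> it only says that consecutive values of \<open>y_num r\<close> differ by
    \<open>8 * r\<^sup>2 * real n\<close>.\<close>
  have W_rec: "2 * s * W (Suc k) + u (k + 2) * W (k + 2) = (2 * (s + 2 * r) + u (k + 2)) * W k" for k
  proof -
    have "u (k + 2) * W (k + 2) = y_num r (k + 2) + u (k + 2) * (2 * r * real (k + 1) - s)"
      using u_mult[of "k + 2"] by (simp add: W_def algebra_simps)
    moreover have "(2 * (s + 2 * r) + u (k + 2)) * W k =
      (2 * (s + 2 * r) + u (k + 2)) * (s + 2 * r * real (k + 1)) + y_num r (k + 1)"
      using u_mult[of "k + 1"] by (simp add: W_def algebra_simps)
    ultimately show ?thesis
      using y_num_Suc[of r "Suc k"] by (simp add: W_def algebra_simps power2_eq_square)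
  qed
  have v_pos: "v n > 0" if "n \<ge> 1" for n
    using that u_pos W_pos by (simp add: v_def)
  have v_rec: "v n = y_num r n / (2 * s + v (Suc n))" if "n \<ge> 1" for n
  proof -
    obtain k where n: "n = Suc k" using \<open>n \<ge> 1\<close> by (cases n) auto
    have "v n * (2 * s + v (Suc n)) = u (Suc k) * (2 * s * W (Suc k) + u (k + 2) * W (k + 2)) / W k"
      using less_imp_neq[OF W_pos[of k]] less_imp_neq[OF W_pos[of "Suc k"]]
      by (simp add: v_def n algebra_simps add_divide_distrib)
    also have "\<dots> = u (Suc k) * (2 * (s + 2 * r) + u (k + 2))"
      unfolding W_rec using W_pos[of k] by simp
    also have "\<dots> = y_num r n" using u_mult[of "Suc k"] by (simp add: n)
    finally have "v n * (2 * s + v (Suc n)) = y_num r n" .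
    moreover have "2 * s + v (Suc n) > 0" using v_pos[of "Suc n"] s by simp
    ultimately show ?thesis by (simp add: eq_divide_eq)
  qed
  have "yfun s r = s + v 1" using Y.cfK_eq_tail[OF v_pos v_rec] by (simp add: yfun_def)
  moreover have "yfun (s + 2 * r) r = W 0" using u_val by (simp add: yfun_def W_def)
  \<comment> \<open>The denominator \<open>W 0\<close> of \<open>v 1\<close> is the second factor of
    the product, so it cancels; then the terms with \<open>u 1\<close> cancel as well.\<close>
  moreover have "(s + v 1) * W 0 = s * W 0 + u 1 * W 1"
    using W_pos[of 0] by (simp add: v_def field_simps)
  moreover have "u 1 * W 1 = y_num r 1 - s * u 1"
    using u_mult[of 1] by (simp add: W_def algebra_simps numeral_2_eq_2)
  ultimately show ?thesis
    by (simp add: W_def y_num_def power2_eq_square algebra_simps)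
qed

section \<open>The fraction \<open>TK\<close>, two levels at a time\<close>

lemma pos_cf_tk:
  assumes "A > 0" "c > 0"
  shows "pos_cf (tk_num A) (tk_den c) (sqrt A) (min 1 c)"
proof
  fix n :: nat assume n: "n \<ge> 1"
  then have "(n + 1) div 2 \<ge> 1" by simp
  then show "tk_num A n > 0" using assms by (simp add: tk_num_def)
  have "real ((n + 1) div 2) \<le> real n" using n by simp
  then have "tk_num A n \<le> A * (real n)\<^sup>2"
    unfolding tk_num_def using assms by (intro mult_left_mono power_mono) auto
  then show "tk_num A n \<le> (sqrt A * real n)\<^sup>2" using assms by (simp add: power_mult_distrib)
qed (use assms in \<open>auto simp: tk_den_def\<close>)

text \<open>Levels with denominators \<open>1\<close> and \<open>c\<close> are merged into one by
  \<open>a / (1 + a / T) = a * T / (T + a)\<close>. Each \<open>T n\<close> includes the leading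
  \<open>c\<close>, so \<open>T 0\<close> is the whole quantity.\<close>

lemma TK_tails_exist:
  assumes "A > 0" "c > 0"
  obtains T where "\<And>n. T n > c"
    "\<And>n. T n = c + A * (real (Suc n))\<^sup>2 * T (Suc n) / (T (Suc n) + A * (real (Suc n))\<^sup>2)"
    "TK c A = T 0"
proof -
  interpret pos_cf "tk_num A" "tk_den c" "sqrt A" "min 1 c" by (rule pos_cf_tk[OF assms])
  obtain u where u_pos: "\<And>n. n \<ge> 1 \<Longrightarrow> u n > 0"
    and u_rec: "\<And>n. n \<ge> 1 \<Longrightarrow> u n = tk_num A n / (tk_den c n + u (Suc n))"
    and u_val: "cfK (tk_num A) (tk_den c) = u 1"
    using cf_tails_exist by blast
  define T where "T n = c + u (2 * n + 1)" for n
  show ?thesis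
  proof
    show "T n > c" for n using u_pos[of "2 * n + 1"] by (simp add: T_def)
    show "TK c A = T 0" by (simp add: TK_def T_def u_val)
    show "T n = c + A * (real (Suc n))\<^sup>2 * T (Suc n) / (T (Suc n) + A * (real (Suc n))\<^sup>2)" for n
    proof -
      define a where "a = A * (real (Suc n))\<^sup>2"
      have T: "T (Suc n) > 0" using u_pos[of "2 * n + 3"] assms by (simp add: T_def eval_nat_numeral)
      have a: "a > 0" using assms by (simp add: a_def)
      have "u (2 * n + 2) = a / T (Suc n)"
        using u_rec[of "2 * n + 2"] by (simp add: T_def a_def tk_num_def tk_den_def numeral_3_eq_3)
      moreover have "u (2 * n + 1) = a / (1 + u (2 * n + 2))"
        using u_rec[of "2 * n + 1"] by (simp add: a_def tk_num_def tk_den_def)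
      moreover have "a / (1 + a / T (Suc n)) = a * T (Suc n) / (T (Suc n) + a)"
        using T a by (simp add: field_simps)
      ultimately have "u (2 * n + 1) = a * T (Suc n) / (T (Suc n) + a)" by simp
      then show ?thesis unfolding a_def[symmetric] by (simp add: T_def)
    qed
  qed
qed

lemma TK_eq_tail:
  assumes A: "A > 0" and c: "c > 0" and T_pos: "\<And>n. T n > 0"
    and T_rec: "\<And>n. T n = c + A * (real (Suc n))\<^sup>2 * T (Suc n) / (T (Suc n) + A * (real (Suc n))\<^sup>2)"
  shows "TK c A = T 0"
proof -
  interpret pos_cf "tk_num A" "tk_den c" "sqrt A" "min 1 c" by (rule pos_cf_tk[OF A c])
  \<comment> \<open>Undoes the merging: odd indices drop the leading \<open>c\<close>, even indices
    hold the intermediate tail. Positivity at odd indices is \<open>T_gt\<close>.\<close>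
  define u where "u k = (if odd k then T (k div 2) - c else A * (real (k div 2))\<^sup>2 / T (k div 2))" for k
  have T_gt: "T n > c" for n
  proof -
    have "A * (real (Suc n))\<^sup>2 * T (Suc n) / (T (Suc n) + A * (real (Suc n))\<^sup>2) > 0"
      using A T_pos[of "Suc n"] by (intro divide_pos_pos add_pos_pos mult_pos_pos) auto
    then show ?thesis using T_rec[of n] by linarith
  qed
  have "cfK (tk_num A) (tk_den c) = u 1"
  proof (rule cfK_eq_tail)
    fix n :: nat assume n: "n \<ge> 1"
    show "u n > 0"
    proof (cases "odd n")
      case False
      then have "n div 2 \<ge> 1" using n by auto
      then show ?thesis using False A T_pos by (simp add: u_def)
    qed (use T_gt in \<open>simp add: u_def\<close>)
    show "u n = tk_num A n / (tk_den c n + u (Suc n))"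
    proof (cases "odd n")
      case True
      then obtain m where m: "n = 2 * m + 1" by (rule oddE)
      define a where "a = A * (real (Suc m))\<^sup>2"
      have a: "a > 0" using A by (simp add: a_def)
      have "u n = a * T (Suc m) / (T (Suc m) + a)"
        using T_rec[of m] by (simp add: u_def m a_def)
      also have "\<dots> = a / (1 + a / T (Suc m))"
        using a T_pos[of "Suc m"] by (simp add: field_simps)
      finally show ?thesis by (simp add: m u_def tk_num_def tk_den_def a_def)
    next
      case False
      then have "even n" by simp
      then obtain m where "n = 2 * m" by (rule evenE)
      then show ?thesis by (simp add: u_def tk_num_def tk_den_def)
    qed
  qed
  then show ?thesis by (simp add: TK_def u_def)
qed

lemma TK_gt:
  assumes "A > 0" "c > 0"
  shows "TK c A > c"
proof (rule TK_tails_exist[OF assms])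
  fix T :: "nat \<Rightarrow> real"
  assume "\<And>n. T n > c" "TK c A = T 0"
  then show ?thesis by simp
qed

text \<open>With \<open>\<nu> = e - 1\<close>, the map \<open>Y \<mapsto> N n Y / D n Y\<close> carries the \<open>n\<close>-th tail at \<open>\<nu> + 1\<close> to
  the \<open>n\<close>-th tail at \<open>\<nu>\<close>. It is this direction of the shift that preserves positivity.\<close>

lemma TK_contiguity:
  fixes A e n X Y :: real
  defines "k \<equiv> n + 1" and "a \<equiv> A * (n + 1)\<^sup>2" and "c \<equiv> A * (e - 1) * e" and "c' \<equiv> A * e * (e + 1)"
  defines "N \<equiv> \<lambda>n Y. 2 * A\<^sup>2 * n\<^sup>2 * e\<^sup>2 + A * e * (e + 2 * n) * Y"
    and "D \<equiv> \<lambda>n Y. 2 * Y + A * e * (2 * n - e)"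
  assumes Y: "Y = c' + a * X / (X + a)" and X: "X + a \<noteq> 0"
    and D: "D n Y \<noteq> 0" "D k X \<noteq> 0" "N k X / D k X + a \<noteq> 0"
  shows "N n Y / D n Y = c + a * (N k X / D k X) / (N k X / D k X + a)"
proof -
  \<comment> \<open>Multiplied by \<open>P\<close>, both \<open>N n Y\<close> and
    \<open>D n Y\<close> become polynomial in \<open>X\<close>, so the claim splits into the
    identities \<open>DP\<close> and \<open>NP\<close>.\<close>
  define P where "P = X + a"
  have YP: "Y * P = c' * P + a * X" using X by (simp add: Y P_def field_simps)
  have ND: "N k X + a * D k X \<noteq> 0" using D by (simp add: field_simps)
  have "D n Y * P = 2 * (Y * P) + A * e * (2 * n - e) * P" by (simp add: D_def algebra_simps)
  also have "\<dots> = N k X + a * D k X"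
    unfolding YP by (simp add: P_def N_def D_def c'_def a_def k_def power2_eq_square algebra_simps)
  finally have DP: "D n Y * P = N k X + a * D k X" .
  have "N n Y * P = 2 * A\<^sup>2 * n\<^sup>2 * e\<^sup>2 * P + A * e * (e + 2 * n) * (Y * P)"
    by (simp add: N_def algebra_simps)
  also have "\<dots> = c * (N k X + a * D k X) + a * N k X"
    unfolding YP by (simp add: P_def N_def D_def c_def c'_def a_def k_def power2_eq_square algebra_simps)
  finally have NP: "N n Y * P = c * (N k X + a * D k X) + a * N k X" .
  have "N n Y / D n Y = (N n Y * P) / (D n Y * P)" using X by (simp add: P_def)
  also have "\<dots> = c + a * N k X / (N k X + a * D k X)"
    unfolding NP DP using ND by (simp add: add_divide_distrib)
  also have "a * N k X / (N k X + a * D k X) = a * (N k X / D k X) / (N k X / D k X + a)"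
    using D(2) ND by (simp add: divide_simps)
  finally show ?thesis .
qed

text \<open>At index 0 the contiguity map is
  \<open>X \<mapsto> A * e\<^sup>2 * X / (2 * X - A * e\<^sup>2)\<close>, which is additive in
  reciprocals: \<open>1 / T 0 + 1 / X 0 = 2 / (A * e\<^sup>2)\<close>.\<close>

lemma inverse_TK_functional_equation:
  assumes A: "A > 0" and \<nu>: "\<nu> > 0"
  shows "1 / TK (A * \<nu> * (\<nu> + 1)) A + 1 / TK (A * (\<nu> + 1) * (\<nu> + 2)) A = 2 / (A * (\<nu> + 1)\<^sup>2)"
proof -
  define e where "e = \<nu> + 1"
  have e: "e > 1" using \<nu> by (simp add: e_def)
  obtain X where X_gt: "\<And>n. X n > A * e * (e + 1)"
    and X_rec: "\<And>n. X n = A * e * (e + 1) + A * (real (Suc n))\<^sup>2 * X (Suc n) / (X (Suc n) + A * (real (Suc n))\<^sup>2)"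
    and X_val: "TK (A * e * (e + 1)) A = X 0"
  proof -
    have "A * e * (e + 1) > 0" using A e by simp
    from TK_tails_exist[OF A this] show ?thesis using that by blast
  qed
  define N where "N n Y = 2 * A\<^sup>2 * n\<^sup>2 * e\<^sup>2 + A * e * (e + 2 * n) * Y" for n Y :: real
  define D where "D n Y = 2 * Y + A * e * (2 * n - e)" for n Y :: real
  define T where "T n = N (real n) (X n) / D (real n) (X n)" for n
  have X_pos: "X n > 0" for n
  proof -
    have "A * e * (e + 1) > 0" using A e by simp
    with X_gt[of n] show ?thesis by linarith
  qed
  have D_pos: "D (real n) (X n) > 0" for n
  proof -
    \<comment> \<open>The possibly negative summand of \<open>D\<close> is outweighed by twice the
      lower bound of \<open>X n\<close>.\<close>
    have "0 < A * e * (e + 2 + 2 * real n)" using A e by (intro mult_pos_pos) auto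
    also have "\<dots> = 2 * (A * e * (e + 1)) + A * e * (2 * real n - e)" by (simp add: algebra_simps)
    also have "\<dots> < D (real n) (X n)" using X_gt[of n] by (simp add: D_def)
    finally show ?thesis .
  qed
  have N_pos: "N (real n) (X n) > 0" for n
  proof -
    have "e + 2 * real n > 0" using e by simp
    then have "A * e * (e + 2 * real n) * X n > 0" using A e X_pos[of n] by simp
    then show ?thesis unfolding N_def by (rule add_nonneg_pos[rotated]) simp
  qed
  have T_pos: "T n > 0" for n using N_pos D_pos by (simp add: T_def)
  have T_rec: "T n = A * (e - 1) * e + A * (real (Suc n))\<^sup>2 * T (Suc n) / (T (Suc n) + A * (real (Suc n))\<^sup>2)" for n
  proof -
    have a: "A * (real n + 1)\<^sup>2 > 0" using A by (intro mult_pos_pos zero_less_power) simp_all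
    have S: "real (Suc n) = real n + 1" by simp
    have "N (real n) (X n) / D (real n) (X n) = A * (e - 1) * e + A * (real n + 1)\<^sup>2 *
      (N (real n + 1) (X (Suc n)) / D (real n + 1) (X (Suc n))) /
      (N (real n + 1) (X (Suc n)) / D (real n + 1) (X (Suc n)) + A * (real n + 1)\<^sup>2)"
      unfolding N_def D_def
    proof (rule TK_contiguity)
      show "X n = A * e * (e + 1) + A * (real n + 1)\<^sup>2 * X (Suc n) / (X (Suc n) + A * (real n + 1)\<^sup>2)"
        using X_rec[of n] unfolding S .
      show "X (Suc n) + A * (real n + 1)\<^sup>2 \<noteq> 0" using a X_pos[of "Suc n"] by linarith
    qed (use D_pos[of n] D_pos[of "Suc n"] T_pos[of "Suc n"] a in \<open>simp_all add: T_def N_def D_def add.commute[of 1]\<close>)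
    then show ?thesis unfolding T_def S .
  qed
  have "TK (A * (e - 1) * e) A = T 0"
    by (rule TK_eq_tail[OF A _ T_pos T_rec]) (use A e in simp)
  moreover have "1 / T 0 = 2 / (A * e\<^sup>2) - 1 / X 0"
    using A e X_pos[of 0] D_pos[of 0] by (simp add: T_def N_def D_def field_simps power2_eq_square)
  ultimately have "1 / TK (A * (e - 1) * e) A + 1 / TK (A * e * (e + 1)) A = 2 / (A * e\<^sup>2)"
    using X_val by simp
  then show ?thesis by (simp add: e_def add.assoc)
qed

section \<open>Gamma quotients and the integral\<close>

text \<open>The absolute value is constant along \<open>x, x + 1, ...\<close>, so decay forces it to
  vanish. Applied to differences, this gives uniqueness of decaying solutions of
  \<open>F x + F (x + 1) = g x\<close>.\<close>

lemma alternating_eq_0: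
  fixes F :: "real \<Rightarrow> real"
  assumes alt: "\<And>x. x > 0 \<Longrightarrow> F x + F (x + 1) = 0"
    and lim: "(\<lambda>n. F (x + real n)) \<longlonglongrightarrow> 0" and x: "x > 0"
  shows "F x = 0"
proof -
  have "\<bar>F (x + real n)\<bar> = \<bar>F x\<bar>" for n
  proof (induction n)
    case (Suc n)
    have "F (x + real n) + F (x + real n + 1) = 0" using x by (intro alt) simp
    with Suc show ?case by (simp add: add_ac)
  qed simp
  then have "(\<lambda>n. \<bar>F x\<bar>) \<longlonglongrightarrow> 0" using tendsto_rabs_zero[OF lim] by simp
  then show ?thesis by (simp add: LIMSEQ_const_iff)
qed

text \<open>A positive solution of \<open>f x * f (x + 1/2) = x\<close> that grows like the square
  root of \<open>x\<close>: the building block for the equation of \<open>yfun\<close>.\<close>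

definition Gamma_half_ratio :: "real \<Rightarrow> real" where
  "Gamma_half_ratio x = Gamma (x + 1/2) / Gamma x"

lemma Gamma_half_ratio_pos: "x > 0 \<Longrightarrow> Gamma_half_ratio x > 0"
  by (simp add: Gamma_half_ratio_def)

lemma Gamma_half_ratio_mult:
  assumes "x > 0"
  shows "Gamma_half_ratio x * Gamma_half_ratio (x + 1/2) = x"
proof -
  have "Gamma (x + 1) = x * Gamma x" using assms by (intro Gamma_plus1) auto
  moreover have "Gamma x > 0" "Gamma (x + 1/2) > 0" using assms by auto
  ultimately show ?thesis by (simp add: Gamma_half_ratio_def add.assoc)
qed

text \<open>Log-convexity of Gamma at the midpoint of \<open>x\<close> and
  \<open>x + 1\<close>.\<close>

lemma Gamma_half_ratio_mono:
  assumes "x > 0"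
  shows "Gamma_half_ratio x \<le> Gamma_half_ratio (x + 1/2)"
proof -
  have "(ln \<circ> Gamma) ((1 - 1/2) *\<^sub>R x + (1/2) *\<^sub>R (x + 1)) \<le>
    (1 - 1/2) * (ln \<circ> Gamma) x + (1/2) * (ln \<circ> Gamma) (x + 1)"
    by (rule convex_onD[OF log_convex_Gamma_real]) (use assms in auto)
  moreover have "(1 - 1/2) *\<^sub>R x + (1/2) *\<^sub>R (x + 1) = x + 1/2" by (simp add: field_simps)
  ultimately have "2 * ln (Gamma (x + 1/2)) \<le> ln (Gamma x) + ln (Gamma (x + 1))"
    by (simp only: o_def) simp
  moreover have pos: "Gamma x > 0" "Gamma (x + 1/2) > 0" "Gamma (x + 1) > 0" using assms by auto
  ultimately have "ln (Gamma (x + 1/2) / Gamma x) \<le> ln (Gamma (x + 1) / Gamma (x + 1/2))"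
    using pos[THEN less_imp_neq] by (simp add: ln_div)
  then have "Gamma (x + 1/2) / Gamma x \<le> Gamma (x + 1) / Gamma (x + 1/2)"
    using pos by (subst (asm) ln_le_cancel_iff) auto
  then show ?thesis by (simp add: Gamma_half_ratio_def add.assoc)
qed

text \<open>By monotonicity the square lies between the products with the neighbours at
  \<open>x - 1/2\<close> and \<open>x + 1/2\<close>, which are known exactly.\<close>

lemma Gamma_half_ratio_bounds:
  assumes "x > 1/2"
  shows "x - 1/2 \<le> (Gamma_half_ratio x)\<^sup>2" "(Gamma_half_ratio x)\<^sup>2 \<le> x"
proof -
  have "x - 1/2 = Gamma_half_ratio (x - 1/2) * Gamma_half_ratio x"
    using Gamma_half_ratio_mult[of "x - 1/2"] assms by simp
  also have "\<dots> \<le> Gamma_half_ratio x * Gamma_half_ratio x"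
    using Gamma_half_ratio_mono[of "x - 1/2"] Gamma_half_ratio_pos[of x] assms by (intro mult_right_mono) auto
  finally show "x - 1/2 \<le> (Gamma_half_ratio x)\<^sup>2" by (simp add: power2_eq_square)
  have "(Gamma_half_ratio x)\<^sup>2 \<le> Gamma_half_ratio x * Gamma_half_ratio (x + 1/2)"
    unfolding power2_eq_square
    using Gamma_half_ratio_mono[of x] Gamma_half_ratio_pos[of x] assms by (intro mult_left_mono) auto
  then show "(Gamma_half_ratio x)\<^sup>2 \<le> x" using Gamma_half_ratio_mult[of x] assms by simp
qed

text \<open>The quotient \<open>R\<close> of both sides satisfies
  \<open>R s * R (s + 2 * r) = 1\<close>, so it has period \<open>4 * r\<close>; its square tends to
  1 at infinity, and \<open>R\<close> is positive.\<close>

lemma yfun_eq_Gamma: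
  assumes r: "r > 1/2" and s: "s > 0"
  shows "yfun s r = 4 * r * Gamma_half_ratio ((s + 1) / (4 * r)) * Gamma_half_ratio ((s + 2 * r - 1) / (4 * r))"
proof -
  define G where "G s = 4 * r * Gamma_half_ratio ((s + 1) / (4 * r)) * Gamma_half_ratio ((s + 2 * r - 1) / (4 * r))" for s
  define R where "R s = yfun s r / G s" for s
  have G_pos: "G s > 0" if "s > 0" for s
    unfolding G_def using r that by (intro mult_pos_pos Gamma_half_ratio_pos divide_pos_pos) auto
  have y_pos: "yfun s r > 0" if "s > 0" for s
    using yfun_bounds(1)[OF r that] that by simp
  have R_pos: "R s > 0" if "s > 0" for s
    using y_pos[OF that] G_pos[OF that] by (simp add: R_def)
  have G_mult: "G s * G (s + 2 * r) = (s + 1) * (s + 2 * r - 1)" if "s > 0" for s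
  proof -
    \<comment> \<open>The scaling by \<open>4 * r\<close> turns the shift \<open>2 * r\<close> into
      the half step of \<open>Gamma_half_ratio\<close>.\<close>
    have "(s + 2 * r + 1) / (4 * r) = (s + 1) / (4 * r) + 1/2"
      and "(s + 2 * r + 2 * r - 1) / (4 * r) = (s + 2 * r - 1) / (4 * r) + 1/2"
      using r by (simp_all add: field_simps)
    then have "G s * G (s + 2 * r) = (4 * r)\<^sup>2 *
      (Gamma_half_ratio ((s + 1) / (4 * r)) * Gamma_half_ratio ((s + 1) / (4 * r) + 1/2)) *
      (Gamma_half_ratio ((s + 2 * r - 1) / (4 * r)) * Gamma_half_ratio ((s + 2 * r - 1) / (4 * r) + 1/2))"
      unfolding G_def by (simp only:) (simp only: power2_eq_square mult_ac)
    also have "\<dots> = (4 * r)\<^sup>2 * ((s + 1) / (4 * r)) * ((s + 2 * r - 1) / (4 * r))"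
      using r that by (simp add: Gamma_half_ratio_mult)
    also have "\<dots> = (s + 1) * (s + 2 * r - 1)" using r by (simp add: power2_eq_square)
    finally show ?thesis .
  qed
  have R_mult: "R s * R (s + 2 * r) = 1" if "s > 0" for s
  proof -
    have "R s * R (s + 2 * r) = (yfun s r * yfun (s + 2 * r) r) / (G s * G (s + 2 * r))"
      by (simp add: R_def)
    also have "\<dots> = 1"
      unfolding yfun_functional_equation[OF r that] G_mult[OF that]
      by (rule divide_self) (use r that in simp)
    finally show ?thesis .
  qed
  have R_periodic: "R (s + 4 * r * real n) = R s" for n
  proof (induction n)
    case (Suc n)
    define t where "t = s + 4 * r * real n"
    have t: "t > 0" using r s by (simp add: t_def add_pos_nonneg)
    have "R t * R (t + 2 * r) = 1" "R (t + 2 * r) * R (t + 4 * r) = 1"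
      using R_mult[of t] R_mult[of "t + 2 * r"] t r by (simp_all add: add.assoc)
    then have "R (t + 4 * r) = R t"
      by (metis mult.commute mult.left_commute mult.right_neutral)
    moreover have "s + 4 * r * real (Suc n) = t + 4 * r" by (simp add: t_def algebra_simps)
    ultimately show ?case using Suc by (simp only: t_def)
  qed simp
  have le: "(R t)\<^sup>2 \<le> (t + (2 * r - 1) / (2 * t))\<^sup>2 / ((t + 1 - 2 * r) * (t - 1))"
    and ge: "t\<^sup>2 / ((t + 1) * (t + 2 * r - 1)) \<le> (R t)\<^sup>2"
    if t: "t > 1" "t > 2 * r - 1" for t
  proof -
    define a b where "a = (t + 1) / (4 * r)" and "b = (t + 2 * r - 1) / (4 * r)"
    \<comment> \<open>\<open>t > 2 * r - 1\<close> gives the first inequality and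
      \<open>t > 1\<close> the second.\<close>
    have ab: "a > 1/2" "b > 1/2" using t r by (simp_all add: a_def b_def field_simps)
    have G2: "(G t)\<^sup>2 = (4 * r)\<^sup>2 * ((Gamma_half_ratio a)\<^sup>2 * (Gamma_half_ratio b)\<^sup>2)"
      by (simp add: G_def a_def b_def power_mult_distrib)
    have "(a - 1/2) * (b - 1/2) \<le> (Gamma_half_ratio a)\<^sup>2 * (Gamma_half_ratio b)\<^sup>2"
      using Gamma_half_ratio_bounds[of a] Gamma_half_ratio_bounds[of b] ab by (intro mult_mono) auto
    then have "(4 * r)\<^sup>2 * ((a - 1/2) * (b - 1/2)) \<le> (G t)\<^sup>2" unfolding G2 by (intro mult_left_mono) auto
    moreover have "(4 * r)\<^sup>2 * ((a - 1/2) * (b - 1/2)) = (t + 1 - 2 * r) * (t - 1)"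
      using r by (simp add: a_def b_def field_simps power2_eq_square)
    ultimately have G_ge: "(t + 1 - 2 * r) * (t - 1) \<le> (G t)\<^sup>2" by simp
    have "(Gamma_half_ratio a)\<^sup>2 * (Gamma_half_ratio b)\<^sup>2 \<le> a * b"
      using Gamma_half_ratio_bounds[of a] Gamma_half_ratio_bounds[of b] ab by (intro mult_mono) auto
    then have "(G t)\<^sup>2 \<le> (4 * r)\<^sup>2 * (a * b)" unfolding G2 by (intro mult_left_mono) auto
    moreover have "(4 * r)\<^sup>2 * (a * b) = (t + 1) * (t + 2 * r - 1)"
      using r by (simp add: a_def b_def power2_eq_square)
    ultimately have G_le: "(G t)\<^sup>2 \<le> (t + 1) * (t + 2 * r - 1)" by simp
    have t0: "t > 0" using t by simp
    have R2: "(R t)\<^sup>2 = (yfun t r)\<^sup>2 / (G t)\<^sup>2" by (simp add: R_def power_divide)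
    show "(R t)\<^sup>2 \<le> (t + (2 * r - 1) / (2 * t))\<^sup>2 / ((t + 1 - 2 * r) * (t - 1))"
      unfolding R2 using yfun_bounds(2)[OF r t0] y_pos[OF t0] G_ge t
      by (intro frac_le power_mono) auto
    show "t\<^sup>2 / ((t + 1) * (t + 2 * r - 1)) \<le> (R t)\<^sup>2"
      unfolding R2 using yfun_bounds(1)[OF r t0] y_pos[OF t0] G_le G_pos[OF t0] t
      by (intro frac_le power_mono) auto
  qed
  have "((\<lambda>t. (R t)\<^sup>2) \<longlongrightarrow> 1) at_top"
  proof (rule tendsto_sandwich)
    have ev: "eventually (\<lambda>t. t > 1 \<and> t > 2 * r - 1) at_top"
      by (intro eventually_conj eventually_gt_at_top)
    show "eventually (\<lambda>t. t\<^sup>2 / ((t + 1) * (t + 2 * r - 1)) \<le> (R t)\<^sup>2) at_top"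
      using ev by eventually_elim (use ge in auto)
    show "eventually (\<lambda>t. (R t)\<^sup>2 \<le> (t + (2 * r - 1) / (2 * t))\<^sup>2 / ((t + 1 - 2 * r) * (t - 1))) at_top"
      using ev by eventually_elim (use le in auto)
    show "((\<lambda>t. t\<^sup>2 / ((t + 1) * (t + 2 * r - 1))) \<longlongrightarrow> 1) at_top" by real_asymp
    show "((\<lambda>t. (t + (2 * r - 1) / (2 * t))\<^sup>2 / ((t + 1 - 2 * r) * (t - 1))) \<longlongrightarrow> 1) at_top" by real_asymp
  qed
  moreover have "filterlim (\<lambda>n. s + 4 * r * real n) at_top sequentially"
    using r by real_asymp
  ultimately have "(\<lambda>n. (R (s + 4 * r * real n))\<^sup>2) \<longlonglongrightarrow> 1" by (rule filterlim_compose)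
  then have "(R s)\<^sup>2 = 1" by (simp add: R_periodic LIMSEQ_const_iff)
  then have "R s = 1" using R_pos[OF s] by (simp add: power2_eq_1_iff)
  then show ?thesis using G_pos[OF s] by (simp add: R_def G_def)
qed

text \<open>The trigamma value at \<open>x + real n\<close> is the remainder after \<open>n\<close>
  terms of the convergent series for its value at \<open>x\<close>.\<close>

lemma Polygamma_1_tendsto_0:
  fixes x :: real
  assumes "x > 0"
  shows "(\<lambda>n. Polygamma 1 (x + real n)) \<longlonglongrightarrow> 0"
proof -
  have summ: "summable (\<lambda>k. inverse ((x + real k)\<^sup>2))"
    using Polygamma_converges'[of x 2] assms by simp
  have "Polygamma 1 (x + real n) = Polygamma 1 x - (\<Sum>k<n. inverse ((x + real k)\<^sup>2))" for n
    using Polygamma_plus_of_nat[of n x 1] assms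
    by (simp add: inverse_eq_divide add_eq_0_iff2 numeral_2_eq_2)
  moreover have "Polygamma 1 x = (\<Sum>k. inverse ((x + real k)\<^sup>2))"
    by (simp add: Polygamma_def numeral_2_eq_2)
  ultimately have "(\<lambda>n. Polygamma 1 (x + real n)) = (\<lambda>n. (\<Sum>k. inverse ((x + real k)\<^sup>2)) - (\<Sum>k<n. inverse ((x + real k)\<^sup>2)))"
    by simp
  moreover have "\<dots> \<longlonglongrightarrow> (\<Sum>k. inverse ((x + real k)\<^sup>2)) - (\<Sum>k. inverse ((x + real k)\<^sup>2))"
    by (intro tendsto_intros summable_LIMSEQ summ)
  ultimately show ?thesis by simp
qed

text \<open>The exponent is normalised so that the shift to \<open>\<nu> + 1\<close> is the one in
  the equation for \<open>TK (A * \<nu> * (\<nu> + 1)) A\<close>.\<close>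

definition sech_integral :: "real \<Rightarrow> real" where
  "sech_integral \<nu> = (\<integral>x\<in>{0..}. x * exp (- (2 * \<nu> + 1) * x) / cosh x \<partial>lborel)"

lemma exp_moment:
  fixes \<alpha> :: real
  assumes \<alpha>: "\<alpha> > 0"
  shows "has_bochner_integral lborel (\<lambda>x. indicator {0..} x *\<^sub>R (x * exp (- \<alpha> * x))) (1 / \<alpha>\<^sup>2)"
proof -
  have "(\<integral>\<^sup>+x. ennreal (x * exp (- \<alpha> * x)) * indicator {0..} x \<partial>lborel) =
     ennreal (0 - (- (0 / \<alpha> + 1 / \<alpha>\<^sup>2) * exp (- \<alpha> * 0)))"
  proof (rule nn_integral_FTC_atLeast)
    show "((\<lambda>x. - (x / \<alpha> + 1 / \<alpha>\<^sup>2) * exp (- \<alpha> * x)) has_real_derivative x * exp (- \<alpha> * x)) (at x)" for x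
      using \<alpha> by (auto intro!: derivative_eq_intros simp: field_simps power2_eq_square)
    show "((\<lambda>x. - (x / \<alpha> + 1 / \<alpha>\<^sup>2) * exp (- \<alpha> * x)) \<longlongrightarrow> 0) at_top"
      using \<alpha> by real_asymp
  qed auto
  also have "(\<lambda>x. ennreal (x * exp (- \<alpha> * x)) * indicator {0..} x) =
     (\<lambda>x. ennreal (indicator {0..} x *\<^sub>R (x * exp (- \<alpha> * x))))"
    by (auto simp: indicator_def)
  finally show ?thesis
    by (intro has_bochner_integral_nn_integral) (auto simp: indicator_def)
qed

lemma set_integrable_sech:
  fixes \<alpha> :: real
  assumes "\<alpha> > 0"
  shows "set_integrable lborel {0..} (\<lambda>x. x * exp (- \<alpha> * x) / cosh x)"
proof (rule set_integrable_bound)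
  show "set_integrable lborel {0..} (\<lambda>x. x * exp (- \<alpha> * x))"
    using exp_moment[OF assms] by (auto simp: set_integrable_def has_bochner_integral_iff)
  show "AE x in lborel. x \<in> {0..} \<longrightarrow> norm (x * exp (- \<alpha> * x) / cosh x) \<le> norm (x * exp (- \<alpha> * x))"
  proof (intro always_eventually allI impI)
    fix x :: real assume "x \<in> {0..}"
    then have "x * exp (- \<alpha> * x) / cosh x \<le> x * exp (- \<alpha> * x) / 1"
      by (intro divide_left_mono) (auto simp: cosh_real_ge_1)
    then show "norm (x * exp (- \<alpha> * x) / cosh x) \<le> norm (x * exp (- \<alpha> * x))"
      using \<open>x \<in> {0..}\<close> by (simp add: abs_mult abs_divide)
  qed
  have "(\<lambda>x. x * exp (- \<alpha> * x) / cosh x) \<in> borel_measurable borel"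
    by (intro borel_measurable_continuous_onI continuous_intros) auto
  then show "set_borel_measurable lborel {0..} (\<lambda>x. x * exp (- \<alpha> * x) / cosh x)"
    unfolding set_borel_measurable_def by (intro borel_measurable_scaleR) simp_all
qed

lemma sech_integral_nonneg: "sech_integral \<nu> \<ge> 0"
  unfolding sech_integral_def set_lebesgue_integral_def
  by (intro integral_nonneg_AE always_eventually allI) (auto simp: indicator_def)

text \<open>The sum of the integrands contains \<open>exp x + exp (- x) = 2 * cosh x\<close>, which
  cancels the kernel and leaves an elementary moment.\<close>

lemma sech_integral_add:
  assumes "\<nu> > 0"
  shows "sech_integral \<nu> + sech_integral (\<nu> + 1) = 1 / (2 * (\<nu> + 1)\<^sup>2)"
proof -
  have *: "x * exp (- (2 * \<nu> + 1) * x) / cosh x + x * exp (- (2 * (\<nu> + 1) + 1) * x) / cosh x =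
    2 * (x * exp (- (2 * \<nu> + 2) * x))" for x :: real
  proof -
    have "exp (- (2 * \<nu> + 1) * x) = exp (- (2 * \<nu> + 2) * x) * exp x"
      and "exp (- (2 * (\<nu> + 1) + 1) * x) = exp (- (2 * \<nu> + 2) * x) * exp (- x)"
      by (simp_all add: exp_add[symmetric] algebra_simps)
    then have "x * exp (- (2 * \<nu> + 1) * x) + x * exp (- (2 * (\<nu> + 1) + 1) * x) =
      2 * (x * exp (- (2 * \<nu> + 2) * x)) * cosh x"
      by (simp add: cosh_def algebra_simps)
    then show ?thesis by (simp add: add_divide_distrib[symmetric])
  qed
  have "sech_integral \<nu> + sech_integral (\<nu> + 1) =
    (\<integral>x\<in>{0..}. x * exp (- (2 * \<nu> + 1) * x) / cosh x + x * exp (- (2 * (\<nu> + 1) + 1) * x) / cosh x \<partial>lborel)"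
    unfolding sech_integral_def using assms
    by (intro set_integral_add(2)[symmetric] set_integrable_sech) auto
  also have "\<dots> = 2 * (\<integral>x\<in>{0..}. x * exp (- (2 * \<nu> + 2) * x) \<partial>lborel)"
    unfolding * by simp
  also have "(\<integral>x\<in>{0..}. x * exp (- (2 * \<nu> + 2) * x) \<partial>lborel) = 1 / (2 * \<nu> + 2)\<^sup>2"
    unfolding set_lebesgue_integral_def
    using exp_moment[of "2 * \<nu> + 2"] assms by (intro has_bochner_integral_integral_eq) auto
  also have "2 * (1 / (2 * \<nu> + 2)\<^sup>2) = 1 / (2 * (\<nu> + 1)\<^sup>2)"
  proof -
    have "2 * \<nu> + 2 = 2 * (\<nu> + 1)" by simp
    then show ?thesis by (simp only: power_mult_distrib) simp
  qed
  finally show ?thesis .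
qed

text \<open>Both summands in \<open>sech_integral_add\<close> are nonnegative, so each is at most
  the right-hand side.\<close>

lemma sech_integral_tendsto_0:
  assumes "\<nu> > 0"
  shows "(\<lambda>n. sech_integral (\<nu> + real n)) \<longlonglongrightarrow> 0"
proof (rule tendsto_sandwich[OF _ _ tendsto_const])
  show "(\<lambda>n. 1 / (2 * (\<nu> + real n + 1)\<^sup>2)) \<longlonglongrightarrow> 0" by real_asymp
  show "\<forall>\<^sub>F n in sequentially. sech_integral (\<nu> + real n) \<le> 1 / (2 * (\<nu> + real n + 1)\<^sup>2)"
  proof (intro always_eventually allI)
    fix n
    have "\<nu> + real n > 0" using assms by simp
    from sech_integral_add[OF this] sech_integral_nonneg[of "\<nu> + real n + 1"]
    show "sech_integral (\<nu> + real n) \<le> 1 / (2 * (\<nu> + real n + 1)\<^sup>2)" by simp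
  qed
qed (auto simp: sech_integral_nonneg)

text \<open>Both sides solve the same alternating equation, \<open>4 / A\<close> matching the
  right-hand sides, and both decay: the left one because \<open>TK c A > c\<close>.\<close>

lemma inverse_TK_eq_sech_integral:
  assumes A: "A > 0" and \<nu>: "\<nu> > 0"
  shows "1 / TK (A * \<nu> * (\<nu> + 1)) A = 4 / A * sech_integral \<nu>"
proof -
  define F where "F \<nu> = 1 / TK (A * \<nu> * (\<nu> + 1)) A - 4 / A * sech_integral \<nu>" for \<nu>
  have "F \<nu> = 0"
  proof (rule alternating_eq_0[OF _ _ \<nu>])
    fix x :: real assume x: "x > 0"
    have "4 / A * sech_integral x + 4 / A * sech_integral (x + 1) = 4 / A * (1 / (2 * (x + 1)\<^sup>2))"
      unfolding sech_integral_add[OF x, symmetric] by (simp add: distrib_left)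
    also have "\<dots> = 2 / (A * (x + 1)\<^sup>2)" by simp
    finally show "F x + F (x + 1) = 0"
      using inverse_TK_functional_equation[OF A x] by (simp add: F_def add.assoc)
  next
    have "(\<lambda>n. 1 / TK (A * (\<nu> + real n) * (\<nu> + real n + 1)) A) \<longlonglongrightarrow> 0"
    proof (rule tendsto_sandwich[OF _ _ tendsto_const])
      have gt: "TK (A * (\<nu> + real n) * (\<nu> + real n + 1)) A > A * (\<nu> + real n) * (\<nu> + real n + 1)"
        and pos: "A * (\<nu> + real n) * (\<nu> + real n + 1) > 0" for n
      proof -
        show "A * (\<nu> + real n) * (\<nu> + real n + 1) > 0" using A \<nu> by (simp add: add_pos_nonneg)
        then show "TK (A * (\<nu> + real n) * (\<nu> + real n + 1)) A > A * (\<nu> + real n) * (\<nu> + real n + 1)"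
          by (rule TK_gt[OF A])
      qed
      show "\<forall>\<^sub>F n in sequentially. 1 / TK (A * (\<nu> + real n) * (\<nu> + real n + 1)) A \<le> 1 / (A * (\<nu> + real n) * (\<nu> + real n + 1))"
        using gt pos by (intro always_eventually allI frac_le) (auto intro: less_imp_le)
      show "\<forall>\<^sub>F n in sequentially. 0 \<le> 1 / TK (A * (\<nu> + real n) * (\<nu> + real n + 1)) A"
        using less_trans[OF pos gt] by (intro always_eventually allI) (simp add: less_imp_le)
      show "(\<lambda>n. 1 / (A * (\<nu> + real n) * (\<nu> + real n + 1))) \<longlonglongrightarrow> 0" using A by real_asymp
    qed
    from tendsto_diff[OF this tendsto_mult[OF tendsto_const sech_integral_tendsto_0[OF \<nu>]], of "4 / A"]
    show "(\<lambda>n. F (\<nu> + real n)) \<longlonglongrightarrow> 0" by (simp add: F_def)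
  qed
  then show ?thesis by (simp add: F_def)
qed

text \<open>Raising \<open>\<nu>\<close> by 1 moves the arguments by a half, so two consecutive
  differences telescope to \<open>1 / ((\<nu> + 1) / 2)\<^sup>2\<close>. This is 8 times the
  right-hand side of \<open>sech_integral_add\<close>.\<close>

lemma Polygamma_1_diff_eq_sech_integral:
  assumes \<nu>: "\<nu> > 0"
  shows "Polygamma 1 ((\<nu> + 1) / 2) - Polygamma 1 ((\<nu> + 1) / 2 + 1/2) = 8 * sech_integral \<nu>"
proof -
  define F where "F \<nu> = Polygamma 1 ((\<nu> + 1) / 2) - Polygamma 1 ((\<nu> + 1) / 2 + 1/2) - 8 * sech_integral \<nu>" for \<nu> :: real
  have "F \<nu> = 0"
  proof (rule alternating_eq_0[OF _ _ \<nu>])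
    fix x :: real assume x: "x > 0"
    have "Polygamma 1 ((x + 1) / 2 + 1) = Polygamma 1 ((x + 1) / 2) - 1 / ((x + 1) / 2)\<^sup>2"
      using Polygamma_plus1[of "(x + 1) / 2" 1] x by (simp add: numeral_2_eq_2)
    moreover have "(x + 1 + 1) / 2 = (x + 1) / 2 + 1/2" "(x + 1 + 1) / 2 + 1/2 = (x + 1) / 2 + 1"
      by (simp_all add: field_simps)
    ultimately have "F x + F (x + 1) = 1 / ((x + 1) / 2)\<^sup>2 - 8 * (sech_integral x + sech_integral (x + 1))"
      unfolding F_def by (simp only:) simp
    also have "\<dots> = 0" unfolding sech_integral_add[OF x] using x by (simp add: field_simps)
    finally show "F x + F (x + 1) = 0" .
  next
    \<comment> \<open>Half-integer steps are reduced to integer ones: trigamma is positive and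
      decreasing, so the value at \<open>n div 2\<close> is an upper bound.\<close>
    have lim: "(\<lambda>n. Polygamma 1 (x + real n / 2)) \<longlonglongrightarrow> 0" if "x > 0" for x :: real
    proof (rule tendsto_sandwich[OF _ _ tendsto_const])
      have "filterlim (\<lambda>n::nat. n div 2) at_top sequentially"
        unfolding filterlim_at_top
      proof
        show "\<forall>\<^sub>F n::nat in sequentially. Z \<le> n div 2" for Z
          using eventually_ge_at_top[of "2 * Z"] by eventually_elim simp
      qed
      with Polygamma_1_tendsto_0[OF that]
      show "(\<lambda>n. Polygamma 1 (x + real (n div 2))) \<longlonglongrightarrow> 0" by (rule filterlim_compose)
      show "\<forall>\<^sub>F n in sequentially. Polygamma 1 (x + real n / 2) \<le> Polygamma 1 (x + real (n div 2))"
      proof (intro always_eventually allI)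
        fix n
        have "real (n div 2) \<le> real n / 2" by linarith
        then show "Polygamma 1 (x + real n / 2) \<le> Polygamma 1 (x + real (n div 2))"
          using Polygamma_real_strict_antimono[of "x + real (n div 2)" "x + real n / 2" 1] that
          by (cases "x + real (n div 2) = x + real n / 2") (simp only: order_refl, auto simp: less_imp_le)
      qed
      show "\<forall>\<^sub>F n in sequentially. 0 \<le> Polygamma 1 (x + real n / 2)"
        using Polygamma_real_odd_pos[of _ 1] that
        by (intro always_eventually allI less_imp_le) (auto intro!: Polygamma_real_odd_pos elim!: nonpos_Ints_cases)
    qed
    have "(\<lambda>n. Polygamma 1 ((\<nu> + 1) / 2 + real n / 2) - Polygamma 1 ((\<nu> + 1) / 2 + 1/2 + real n / 2) -
      8 * sech_integral (\<nu> + real n)) \<longlonglongrightarrow> 0 - 0 - 8 * 0"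
      using \<nu> by (intro tendsto_intros lim sech_integral_tendsto_0) (auto intro: add_pos_pos)
    moreover have "F (\<nu> + real n) = Polygamma 1 ((\<nu> + 1) / 2 + real n / 2) -
      Polygamma 1 ((\<nu> + 1) / 2 + 1/2 + real n / 2) - 8 * sech_integral (\<nu> + real n)" for n
    proof -
      have "(\<nu> + real n + 1) / 2 = (\<nu> + 1) / 2 + real n / 2"
        "(\<nu> + real n + 1) / 2 + 1/2 = (\<nu> + 1) / 2 + 1/2 + real n / 2"
        by (simp_all add: field_simps)
      then show ?thesis by (simp only: F_def)
    qed
    ultimately show "(\<lambda>n. F (\<nu> + real n)) \<longlonglongrightarrow> 0" by simp
  qed
  then show ?thesis by (simp add: F_def)
qed

section \<open>The first two derivatives of \<open>ln (yfun u r)\<close>\<close>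

lemma DERIV_affine_arg:
  fixes G :: "real \<Rightarrow> real"
  assumes "\<And>x. x > 0 \<Longrightarrow> (G has_real_derivative g x) (at x)"
    and "c > 0" "t + d > 0" "e \<ge> 0"
  shows "((\<lambda>u. G ((u + d) / c + e)) has_real_derivative g ((t + d) / c + e) / c) (at t)"
proof -
  have "(t + d) / c + e > 0" using assms by (simp add: add_pos_nonneg)
  moreover have "((\<lambda>u. (u + d) / c + e) has_real_derivative 1 / c) (at t)"
    using assms(2) by (auto intro!: derivative_eq_intros)
  ultimately show ?thesis using DERIV_chain2[OF assms(1)] by fastforce
qed

definition dln_y :: "real \<Rightarrow> real \<Rightarrow> real" where
  "dln_y r t = (Digamma ((t + 1) / (4 * r) + 1/2) - Digamma ((t + 1) / (4 * r)) +
     (Digamma ((t + (2 * r - 1)) / (4 * r) + 1/2) - Digamma ((t + (2 * r - 1)) / (4 * r)))) / (4 * r)"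

lemma DERIV_ln_yfun:
  assumes r: "r > 1/2" and t: "t > 0"
  shows "((\<lambda>u. ln (yfun u r)) has_real_derivative dln_y r t) (at t)"
proof -
  define F where "F u = ln (4 * r) +
    (ln_Gamma ((u + 1) / (4 * r) + 1/2) - ln_Gamma ((u + 1) / (4 * r)) +
    (ln_Gamma ((u + (2 * r - 1)) / (4 * r) + 1/2) - ln_Gamma ((u + (2 * r - 1)) / (4 * r))))" for u
  have D: "((\<lambda>u. ln_Gamma ((u + d) / (4 * r) + 1/2)) has_real_derivative Digamma ((t + d) / (4 * r) + 1/2) / (4 * r)) (at t)"
    "((\<lambda>u. ln_Gamma ((u + d) / (4 * r))) has_real_derivative Digamma ((t + d) / (4 * r)) / (4 * r)) (at t)"
    if "d > 0" for d
    using DERIV_affine_arg[OF has_field_derivative_ln_Gamma_real, of "4 * r" t d "1/2"]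
      DERIV_affine_arg[OF has_field_derivative_ln_Gamma_real, of "4 * r" t d 0] r t that by simp_all
  have "(F has_real_derivative 0 + (Digamma ((t + 1) / (4 * r) + 1/2) / (4 * r) - Digamma ((t + 1) / (4 * r)) / (4 * r) +
    (Digamma ((t + (2 * r - 1)) / (4 * r) + 1/2) / (4 * r) - Digamma ((t + (2 * r - 1)) / (4 * r)) / (4 * r)))) (at t)"
    unfolding F_def using r by (intro DERIV_add DERIV_diff DERIV_const D) auto
  then have "(F has_real_derivative dln_y r t) (at t)"
    by (simp add: dln_y_def diff_divide_distrib add_divide_distrib)
  \<comment> \<open>The logarithm of the Gamma formula, available for positive arguments; the
    derivative is transferred on that open half-line.\<close>
  moreover have F_eq: "F u = ln (yfun u r)" if "u \<in> {0<..}" for u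
  proof -
    define a b where "a = (u + 1) / (4 * r)" and "b = (u + (2 * r - 1)) / (4 * r)"
    have "a > 0" "b > 0" using that r by (simp_all add: a_def b_def)
    have ln: "ln (Gamma_half_ratio x) = ln_Gamma (x + 1/2) - ln_Gamma x" if "x > 0" for x
      using that Gamma_real_pos[of x, THEN less_imp_neq] Gamma_real_pos[of "x + 1/2", THEN less_imp_neq]
      by (simp add: Gamma_half_ratio_def ln_div ln_Gamma_real_pos)
    have "yfun u r = 4 * r * (Gamma_half_ratio a * Gamma_half_ratio b)"
      using yfun_eq_Gamma[OF r, of u] that by (simp add: a_def b_def add_diff_eq)
    also have "ln \<dots> = ln (4 * r) + (ln (Gamma_half_ratio a) + ln (Gamma_half_ratio b))"
      using r Gamma_half_ratio_pos[OF \<open>a > 0\<close>] Gamma_half_ratio_pos[OF \<open>b > 0\<close>]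
      by (simp only: ln_mult_pos mult_pos_pos zero_less_numeral)
    finally show ?thesis
      using ln[OF \<open>a > 0\<close>] ln[OF \<open>b > 0\<close>] by (simp add: F_def a_def b_def)
  qed
  ultimately show ?thesis
    by (intro has_field_derivative_transform_within_open[OF _ open_greaterThan _ F_eq]) (use t in auto)
qed

lemma DERIV_dln_y:
  assumes r: "r > 1/2" and s: "s > max 1 (2 * r - 1)"
  shows "(dln_y r has_real_derivative
    - (sech_integral ((s + 1 - 2 * r) / (2 * r)) + sech_integral ((s - 1) / (2 * r))) / (2 * r\<^sup>2)) (at s)"
proof -
  define a b where "a = (s + 1) / (4 * r)" and "b = (s + (2 * r - 1)) / (4 * r)"
  have pos: "a > 0" "b > 0" using r s by (simp_all add: a_def b_def)
  define P where "P x = Polygamma 1 x - Polygamma 1 (x + 1/2)" for x :: real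
  have psi: "(Digamma has_real_derivative Polygamma 1 x) (at x)" if "x > 0" for x :: real
  proof -
    have "x \<notin> \<int>\<^sub>\<le>\<^sub>0" using that by (auto elim!: nonpos_Ints_cases)
    from has_field_derivative_Polygamma[OF this, of 0 UNIV] show ?thesis by simp
  qed
  have D: "((\<lambda>u. Digamma ((u + d) / (4 * r) + 1/2)) has_real_derivative Polygamma 1 ((s + d) / (4 * r) + 1/2) / (4 * r)) (at s)"
    "((\<lambda>u. Digamma ((u + d) / (4 * r))) has_real_derivative Polygamma 1 ((s + d) / (4 * r)) / (4 * r)) (at s)"
    if "d > 0" for d
    using DERIV_affine_arg[OF psi, of "4 * r" s d "1/2"]
      DERIV_affine_arg[OF psi, of "4 * r" s d 0] r s that by simp_all
  have "(dln_y r has_real_derivative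
    (Polygamma 1 (a + 1/2) / (4 * r) - Polygamma 1 a / (4 * r) +
     (Polygamma 1 (b + 1/2) / (4 * r) - Polygamma 1 b / (4 * r))) / (4 * r)) (at s)"
    unfolding dln_y_def a_def b_def using r by (intro DERIV_cdivide DERIV_add DERIV_diff D) auto
  then have "(dln_y r has_real_derivative - (P a + P b) / (4 * r) / (4 * r)) (at s)"
    by (simp add: P_def diff_divide_distrib add_divide_distrib)
  \<comment> \<open>The parameters are found by solving \<open>(\<nu> + 1) / 2 = a\<close> and
    \<open>(\<nu> + 1) / 2 = b\<close>; the bound on \<open>s\<close> makes both positive.\<close>
  moreover have "((s + 1 - 2 * r) / (2 * r) + 1) / 2 = a" "((s - 1) / (2 * r) + 1) / 2 = b"
    using r by (simp_all add: a_def b_def field_simps)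
  then have "P a = 8 * sech_integral ((s + 1 - 2 * r) / (2 * r))" "P b = 8 * sech_integral ((s - 1) / (2 * r))"
    unfolding P_def
    using Polygamma_1_diff_eq_sech_integral[of "(s + 1 - 2 * r) / (2 * r)"]
      Polygamma_1_diff_eq_sech_integral[of "(s - 1) / (2 * r)"] r s by auto
  moreover have "- (8 * x + 8 * y) / (4 * r) / (4 * r) = - (x + y) / (2 * r\<^sup>2)" for x y
    using r by (simp add: power2_eq_square field_simps)
  ultimately show ?thesis by simp
qed

text \<open>Convergence, differentiability and integrability are asserted along with the formulas,
  so that \<open>lim\<close>, \<open>deriv\<close> and the integral denote genuine values.\<close>

theorem theorem12:
  fixes r s :: real
  assumes hr: "r > 1/2" and hs: "s > max 1 (2*r - 1)"
  shows "(\<forall>t. t > max 1 (2*r - 1) \<longrightarrow>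
            cf_converges (y_num r) (\<lambda>n. 2 * t) \<and>
            (\<lambda>u. ln (yfun u r)) differentiable (at t))
       \<and> cf_converges (tk_num (4 * r\<^sup>2)) (tk_den ((1 - 2*r + s) * (1 + s)))
       \<and> cf_converges (tk_num (4 * r\<^sup>2)) (tk_den ((2*r - 1 + s) * (s - 1)))
       \<and> set_integrable lborel {0..}
           (\<lambda>x. x * (exp (- ((1 - r + s) / r) * x) + exp (- ((r - 1 + s) / r) * x)) / cosh x)
       \<and> (deriv (\<lambda>u. ln (yfun u r)) has_real_derivative
            (- 1 / (2 * r\<^sup>2) * (\<integral>x\<in>{0..}.
               x * (exp (- ((1 - r + s) / r) * x) + exp (- ((r - 1 + s) / r) * x)) / cosh x \<partial>lborel)))
           (at s)
       \<and> - 1 / (2 * r\<^sup>2) * (\<integral>x\<in>{0..}.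
               x * (exp (- ((1 - r + s) / r) * x) + exp (- ((r - 1 + s) / r) * x)) / cosh x \<partial>lborel)
         = - h1 s r - h2 s r"
proof -
  \<comment> \<open>The same two parameters factor the constants of \<open>h1\<close> and
    \<open>h2\<close> as \<open>4 * r\<^sup>2 * \<nu> * (\<nu> + 1)\<close> and turn the exponents
    into \<open>2 * \<nu> + 1\<close>.\<close>
  define \<nu>1 \<nu>2 where "\<nu>1 = (s + 1 - 2 * r) / (2 * r)" and "\<nu>2 = (s - 1) / (2 * r)"
  have \<nu>: "\<nu>1 > 0" "\<nu>2 > 0" using hr hs by (simp_all add: \<nu>1_def \<nu>2_def)
  have A: "4 * r\<^sup>2 > 0" using hr by simp
  have c: "(1 - 2*r + s) * (1 + s) > 0" "(2*r - 1 + s) * (s - 1) > 0"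
    using hr hs by simp_all
  have c_eq: "(1 - 2*r + s) * (1 + s) = 4 * r\<^sup>2 * \<nu>1 * (\<nu>1 + 1)"
    "(2*r - 1 + s) * (s - 1) = 4 * r\<^sup>2 * \<nu>2 * (\<nu>2 + 1)"
    using hr by (simp_all add: \<nu>1_def \<nu>2_def field_simps power2_eq_square)
  have exponents: "(1 - r + s) / r = 2 * \<nu>1 + 1" "(r - 1 + s) / r = 2 * \<nu>2 + 1"
    using hr by (simp_all add: \<nu>1_def \<nu>2_def field_simps)
  define f where "f \<nu> x = x * exp (- (2 * \<nu> + 1) * x) / cosh x" for \<nu> x :: real
  have f: "set_integrable lborel {0..} (f \<nu>)" if "\<nu> > 0" for \<nu>
    unfolding f_def using that by (intro set_integrable_sech) simp
  have integrand: "(\<lambda>x. x * (exp (- ((1 - r + s) / r) * x) + exp (- ((r - 1 + s) / r) * x)) / cosh x) =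
    (\<lambda>x. f \<nu>1 x + f \<nu>2 x)"
    unfolding exponents f_def by (simp add: distrib_left add_divide_distrib)
  have integral: "(\<integral>x\<in>{0..}. f \<nu>1 x + f \<nu>2 x \<partial>lborel) = sech_integral \<nu>1 + sech_integral \<nu>2"
    unfolding sech_integral_def f_def[symmetric] by (intro set_integral_add f \<nu>)
  have h: "h1 s r = sech_integral \<nu>1 / (2 * r\<^sup>2)" "h2 s r = sech_integral \<nu>2 / (2 * r\<^sup>2)"
  proof -
    have half: "1 / (2 * T) = (1 / T) / 2" for T :: real by simp
    show "h1 s r = sech_integral \<nu>1 / (2 * r\<^sup>2)"
      unfolding h1_def c_eq half inverse_TK_eq_sech_integral[OF A \<nu>(1)] by simp
    show "h2 s r = sech_integral \<nu>2 / (2 * r\<^sup>2)"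
      unfolding h2_def c_eq half inverse_TK_eq_sech_integral[OF A \<nu>(2)] by simp
  qed
  \<comment> \<open>The first derivative is identified on a whole neighbourhood of \<open>s\<close>,
    as differentiating it once more requires.\<close>
  have "deriv (\<lambda>u. ln (yfun u r)) t = dln_y r t" if "t \<in> {0<..}" for t
    using DERIV_ln_yfun[OF hr, of t] that by (auto intro: DERIV_imp_deriv)
  then have deriv2: "(deriv (\<lambda>u. ln (yfun u r)) has_real_derivative
    - (sech_integral \<nu>1 + sech_integral \<nu>2) / (2 * r\<^sup>2)) (at s)"
    using DERIV_dln_y[OF hr hs] hs unfolding \<nu>1_def \<nu>2_def
    by (elim has_field_derivative_transform_within_open[where S = "{0<..}"]) auto
  show ?thesis
    unfolding integrand integral
  proof (intro conjI allI impI)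
    fix t :: real assume "t > max 1 (2*r - 1)"
    then have t: "t > 0" by simp
    show "cf_converges (y_num r) (\<lambda>n. 2 * t)"
      by (rule pos_cf.cf_converges[OF pos_cf_y[OF hr t]])
    show "(\<lambda>u. ln (yfun u r)) differentiable (at t)"
      using DERIV_ln_yfun[OF hr t] by (auto simp: real_differentiable_def)
  next
    show "cf_converges (tk_num (4 * r\<^sup>2)) (tk_den ((1 - 2*r + s) * (1 + s)))"
      "cf_converges (tk_num (4 * r\<^sup>2)) (tk_den ((2*r - 1 + s) * (s - 1)))"
      by (rule pos_cf.cf_converges[OF pos_cf_tk] A c)+
    show "set_integrable lborel {0..} (\<lambda>x. f \<nu>1 x + f \<nu>2 x)"
      by (intro set_integral_add f \<nu>)
    show "(deriv (\<lambda>u. ln (yfun u r)) has_real_derivative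
      - 1 / (2 * r\<^sup>2) * (sech_integral \<nu>1 + sech_integral \<nu>2)) (at s)"
      using deriv2 by (simp only: minus_divide_left times_divide_eq_left mult_minus_left mult_1)
    show "- 1 / (2 * r\<^sup>2) * (sech_integral \<nu>1 + sech_integral \<nu>2) = - h1 s r - h2 s r"
      unfolding h by (simp add: add_divide_distrib)
  qed
qed

end
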